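(* Let $\mathcal{A},\mathcal{B}$ be sets, $d\geq 1$ an integer, and $\mathcal{R}$ a set of functions from $\mathcal{A}\times\mathcal{B}$ to $\mathbb{R}^d$. Let $(\mu_t^{(1)})_{t\geq 1},\dots,(\mu_t^{(d)})_{t\geq 1}$ be $d$ positive and nonincreasing sequences, and consider the inner products and associated norms $$\langle u,v\rangle_{(t)}:=\sum_{i=1}^d(\mu_t^{(i)})^2u^{(i)}v^{(i)},\qquad \|u\|_{(t)}:=\langle u,u\rangle_{(t)}^{1/2},\qquad u,v\in\mathbb{R}^d,\ t\geq 1,$$ where $u=(u^{(1)},\dots,u^{(d)})$. If $\mathcal{C}=\mathbb{R}_-^d$ satisfies Blackwell's condition with respect to $\mathcal{R}$ and $(\langle\cdot,\cdot\rangle_{(t)})_{t\geq 1}$, then Blackwell's algorithm associated with a corresponding oracle (and any first action $a_1\in\mathcal{A}$) guarantees that, for every sequence $(\rho_t)_{t\geq 1}$ in $\mathcal{R}$ and every sequence $(b_t)_{t\geq 1}$ in $\mathcal{B}$, the outcome vectors $r_t=\rho_t(a_t,b_t)$ satisfy, for each component $1\leq i\leq d$ and all $T\geq 1$, $$\frac1T\sum_{t=1}^T r_t^{(i)}\leq\frac{1}{T\mu_T^{(i)}}\sqrt{\sum_{t=1}^T\|r_t\|_{(t)}^2}.$$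
   Context: $\mathbb{R}_-^d$ is the set of vectors of $\mathbb{R}^d$ with all components $\leq 0$. For $t\geq 1$, $\pi_{(t)}^{\mathcal{C}}(r)=\arg\min_{r'\in\mathcal{C}}\|r'-r\|_{(t)}$. Blackwell's condition: $\mathcal{C}$ satisfies Blackwell's condition with respect to $\mathcal{R}$ and $(\langle\cdot,\cdot\rangle_{(t)})_{t\geq 1}$ if for all $t\geq 1$, $\rho\in\mathcal{R}$, $r\in\mathbb{R}^d$, there exists $a[t,\rho,r]\in\mathcal{A}$ such that for all $b\in\mathcal{B}$, $\langle\rho(a[t,\rho,r],b),\,r-\pi_{(t)}^{\mathcal{C}}(r)\rangle_{(t)}\leq 0$. Such a map $(t,\rho,r)\mapsto a[t,\rho,r]$ is called an oracle associated with $\mathcal{C}$, $\mathcal{R}$ and $(\langle\cdot,\cdot\rangle_{(t)})_{t\geq 1}$. Blackwell's algorithm associated with an oracle $a$ and a first action $a_1\in\mathcal{A}$: given sequences $(\rho_t)_{t\geq1}$ in $\mathcal{R}$ and $(b_t)_{t\geq 1}$ in $\mathcal{B}$, the Decision Maker's actions are $a_1$ at time $1$ and, for $t\geq 2$, $a_t=a\left[t,\rho_t,\sum_{s=1}^{t-1}r_s\right]$, where $r_s:=\rho_s(a_s,b_s)\in\mathbb{R}^d$. *)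

theory Defs
  imports "HOL-Analysis.Analysis"
begin

definition weighted_inner :: "('d::finite \<Rightarrow> nat \<Rightarrow> real) \<Rightarrow> nat \<Rightarrow> real ^ 'd \<Rightarrow> real ^ 'd \<Rightarrow> real" where
  "weighted_inner \<mu> t u v = (\<Sum>i\<in>UNIV. (\<mu> i t)\<^sup>2 * u $ i * v $ i)"

text \<open>A family of inner products is a function \<open>ip\<close> of the time; below, times range over
  \<open>t \<ge> 1\<close> and the value at \<open>0\<close> is irrelevant.\<close>

definition ip_norm :: "(nat \<Rightarrow> real ^ 'd \<Rightarrow> real ^ 'd \<Rightarrow> real) \<Rightarrow> nat \<Rightarrow> real ^ 'd \<Rightarrow> real" where
  "ip_norm ip t u = sqrt (ip t u u)"

text \<open>The library's argmin is a choice operator; the minimiser is unique whenever \<open>ip t\<close> is an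
  inner product and \<open>C\<close> is nonempty, closed and convex, as for the nonpositive orthant.\<close>

definition ip_proj ::
    "(nat \<Rightarrow> real ^ 'd \<Rightarrow> real ^ 'd \<Rightarrow> real) \<Rightarrow> (real ^ 'd) set \<Rightarrow> nat \<Rightarrow> real ^ 'd \<Rightarrow> real ^ 'd" where
  "ip_proj ip C t r = arg_min_on (\<lambda>r'. ip_norm ip t (r' - r)) C"

definition nonpos_orthant :: "(real ^ 'd) set" where
  "nonpos_orthant = {r. \<forall>i. r $ i \<le> 0}"

definition blackwell_condition ::
    "'a set \<Rightarrow> 'b set \<Rightarrow> (nat \<Rightarrow> real ^ 'd \<Rightarrow> real ^ 'd \<Rightarrow> real) \<Rightarrow> (real ^ 'd) set \<Rightarrow>
     ('a \<times> 'b \<Rightarrow> real ^ 'd) set \<Rightarrow> bool" where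
  "blackwell_condition A B ip C R \<longleftrightarrow>
     (\<forall>t\<ge>1. \<forall>\<rho>\<in>R. \<forall>r. \<exists>a\<in>A. \<forall>b\<in>B. ip t (\<rho> (a, b)) (r - ip_proj ip C t r) \<le> 0)"

definition blackwell_oracle ::
    "'a set \<Rightarrow> 'b set \<Rightarrow> (nat \<Rightarrow> real ^ 'd \<Rightarrow> real ^ 'd \<Rightarrow> real) \<Rightarrow> (real ^ 'd) set \<Rightarrow>
     ('a \<times> 'b \<Rightarrow> real ^ 'd) set \<Rightarrow>
     (nat \<Rightarrow> ('a \<times> 'b \<Rightarrow> real ^ 'd) \<Rightarrow> real ^ 'd \<Rightarrow> 'a) \<Rightarrow> bool" where
  "blackwell_oracle A B ip C R orc \<longleftrightarrow>
     (\<forall>t\<ge>1. \<forall>\<rho>\<in>R. \<forall>r. orc t \<rho> r \<in> A \<and>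
        (\<forall>b\<in>B. ip t (\<rho> (orc t \<rho> r, b)) (r - ip_proj ip C t r) \<le> 0))"

text \<open>The action at the unused time \<open>0\<close> is set to \<open>a1\<close>; no sum below involves it.\<close>

fun blackwell_action ::
    "(nat \<Rightarrow> ('a \<times> 'b \<Rightarrow> real ^ 'd) \<Rightarrow> real ^ 'd \<Rightarrow> 'a) \<Rightarrow> 'a \<Rightarrow>
     (nat \<Rightarrow> 'a \<times> 'b \<Rightarrow> real ^ 'd) \<Rightarrow> (nat \<Rightarrow> 'b) \<Rightarrow> nat \<Rightarrow> 'a" where
  "blackwell_action orc a1 \<rho> b t =
     (if t \<le> 1 then a1
      else orc t (\<rho> t) (\<Sum>s\<in>{1..<t}. \<rho> s (blackwell_action orc a1 \<rho> b s, b s)))"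

declare blackwell_action.simps [simp del]

definition blackwell_outcome ::
    "(nat \<Rightarrow> ('a \<times> 'b \<Rightarrow> real ^ 'd) \<Rightarrow> real ^ 'd \<Rightarrow> 'a) \<Rightarrow> 'a \<Rightarrow>
     (nat \<Rightarrow> 'a \<times> 'b \<Rightarrow> real ^ 'd) \<Rightarrow> (nat \<Rightarrow> 'b) \<Rightarrow> nat \<Rightarrow> real ^ 'd" where
  "blackwell_outcome orc a1 \<rho> b t = \<rho> t (blackwell_action orc a1 \<rho> b t, b t)"

end

theory Submission
  imports Defs
begin

text \<open>The projection of \<open>r\<close> onto the nonpositive orthant replaces each component by its minimum
  with \<open>0\<close>, whatever the positive weights, so \<open>r - \<pi> r\<close> is the positive part \<open>r\<^sup>+\<close>. The
  squared norm of the positive part of the cumulative outcome grows by at most \<open>\<parallel>r\<^sub>t\<parallel>\<^sup>2\<close> at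
  step \<open>t\<close>: the cross term is nonpositive by Blackwell's condition, and passing from the norm at
  time \<open>t\<close> to the one at time \<open>t + 1\<close> only decreases it because the weights are nonincreasing.\<close>

definition pos_part :: "real ^ 'd \<Rightarrow> real ^ 'd" where
  "pos_part v = (\<chi> i. max (v $ i) 0)"

lemma pos_part_nth [simp]: "pos_part v $ i = max (v $ i) 0"
  by (simp add: pos_part_def)

lemma ip_norm_weighted_inner_sq:
  "(ip_norm (weighted_inner \<mu>) t u)\<^sup>2 = weighted_inner \<mu> t u u"
  by (simp add: ip_norm_def weighted_inner_def sum_nonneg mult.assoc)

lemma weighted_inner_add_add:
  "weighted_inner \<mu> t (u + v) (u + v)
    = weighted_inner \<mu> t u u + 2 * weighted_inner \<mu> t v u + weighted_inner \<mu> t v v"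
  unfolding weighted_inner_def sum_distrib_left sum.distrib[symmetric]
  by (rule sum.cong) (auto simp: algebra_simps)

lemma weighted_inner_mono_weights:
  assumes "\<And>i. 0 \<le> \<mu> i t" "\<And>i. \<mu> i t \<le> \<mu> i s"
  shows "weighted_inner \<mu> t u u \<le> weighted_inner \<mu> s u u"
  unfolding weighted_inner_def mult.assoc
  by (intro sum_mono mult_right_mono power_mono assms) auto

text \<open>The squared distance splits into one problem per component, each with a positive
  coefficient \<open>(\<mu> i t)\<^sup>2\<close>: a nonpositive number is at distance at least
  \<open>max (r $ i) 0\<close> from \<open>r $ i\<close>, with equality only at the smaller of
  \<open>r $ i\<close> and 0.\<close>

lemma ip_proj_nonpos_orthant:
  fixes \<mu> :: "'d::finite \<Rightarrow> nat \<Rightarrow> real"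
  assumes "\<And>i. \<mu> i t \<noteq> 0"
  shows "ip_proj (weighted_inner \<mu>) nonpos_orthant t r = r - pos_part r"
proof -
  let ?f = "\<lambda>r'. ip_norm (weighted_inner \<mu>) t (r' - r)"
  let ?m = "r - pos_part r"
  have comp: "(\<mu> i t)\<^sup>2 * (?m - r) $ i * (?m - r) $ i
      \<le> (\<mu> i t)\<^sup>2 * (x - r) $ i * (x - r) $ i" if "x \<in> nonpos_orthant" for x i
  proof -
    have "\<bar>max (r $ i) 0\<bar> \<le> \<bar>x $ i - r $ i\<bar>"
      using that by (auto simp: nonpos_orthant_def dest!: spec[of _ i])
    then have "(max (r $ i) 0)\<^sup>2 \<le> (x $ i - r $ i)\<^sup>2"
      unfolding abs_le_square_iff .
    then have "(\<mu> i t)\<^sup>2 * (max (r $ i) 0)\<^sup>2 \<le> (\<mu> i t)\<^sup>2 * (x $ i - r $ i)\<^sup>2"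
      by (intro mult_left_mono) auto
    then show ?thesis
      by (simp add: power2_eq_square mult.assoc)
  qed
  have min: "is_arg_min ?f (\<lambda>x. x \<in> nonpos_orthant) ?m"
    unfolding is_arg_min_linorder
  proof (intro conjI allI impI)
    show "?m \<in> nonpos_orthant"
      by (auto simp: nonpos_orthant_def)
    show "?f ?m \<le> ?f x" if "x \<in> nonpos_orthant" for x
      unfolding ip_norm_def weighted_inner_def
      by (intro real_sqrt_le_mono sum_mono comp that)
  qed
  \<comment> \<open>\<open>arg_min_on\<close> is a choice operator, so its value is known only once
    every minimiser is shown to equal \<open>?m\<close>.\<close>
  have uniq: "x = ?m" if x: "is_arg_min ?f (\<lambda>x. x \<in> nonpos_orthant) x" for x
  proof -
    have xC: "x \<in> nonpos_orthant" and le: "?f x \<le> ?f ?m"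
      using x min by (auto simp: is_arg_min_linorder)
    have "?f x = ?f ?m"
      using le min xC by (auto simp: is_arg_min_linorder intro: antisym)
    then have eq: "(\<Sum>i\<in>UNIV. (\<mu> i t)\<^sup>2 * (?m - r) $ i * (?m - r) $ i)
        = (\<Sum>i\<in>UNIV. (\<mu> i t)\<^sup>2 * (x - r) $ i * (x - r) $ i)"
      by (simp only: ip_norm_def weighted_inner_def real_sqrt_eq_iff)
    have "x $ i = ?m $ i" for i
    proof -
      \<comment> \<open>Equal sums whose summands are ordered by \<open>comp\<close> must agree
        summand by summand.\<close>
      have "(\<mu> i t)\<^sup>2 * (?m - r) $ i * (?m - r) $ i = (\<mu> i t)\<^sup>2 * (x - r) $ i * (x - r) $ i"
        by (rule sum_mono_inv[OF eq comp[OF xC]]) auto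
      then have "(max (r $ i) 0)\<^sup>2 = (x $ i - r $ i)\<^sup>2"
        using assms[of i] by (simp add: power2_eq_square mult.assoc)
      then have "\<bar>max (r $ i) 0\<bar> = \<bar>x $ i - r $ i\<bar>"
        by (simp only: power2_eq_iff abs_eq_iff)
      \<comment> \<open>If \<open>r $ i > 0\<close>, the other sign would give
        \<open>x $ i = 2 * r $ i > 0\<close>, outside the orthant; otherwise both signs
        coincide.\<close>
      then show ?thesis
        using xC by (auto simp: nonpos_orthant_def max_def abs_if dest!: spec[of _ i] split: if_splits)
    qed
    then show ?thesis
      by (simp add: vec_eq_iff)
  qed
  show ?thesis
    unfolding ip_proj_def arg_min_on_def arg_min_def
    using min by (rule someI2) (rule uniq)
qed

text \<open>In each component, either \<open>u $ i + v $ i\<close> is nonpositive and the left side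
  vanishes, or it lies between 0 and \<open>max (u $ i) 0 + v $ i\<close>. With \<open>v\<close>
  outside the positive part, the right side can be expanded.\<close>

lemma weighted_inner_pos_part_add_le:
  "weighted_inner \<mu> t (pos_part (u + v)) (pos_part (u + v))
    \<le> weighted_inner \<mu> t (pos_part u + v) (pos_part u + v)"
  unfolding weighted_inner_def mult.assoc
proof (intro sum_mono mult_left_mono)
  fix i
  have "\<bar>max (u $ i + v $ i) 0\<bar> \<le> \<bar>max (u $ i) 0 + v $ i\<bar>"
    by auto
  then have "(max (u $ i + v $ i) 0)\<^sup>2 \<le> (max (u $ i) 0 + v $ i)\<^sup>2"
    unfolding abs_le_square_iff .
  then show "pos_part (u + v) $ i * pos_part (u + v) $ i
      \<le> (pos_part u + v) $ i * (pos_part u + v) $ i"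
    by (simp add: power2_eq_square)
qed auto

text \<open>By the projection formula, the residual in the oracle's guarantee is the positive part
  of the past sum. The rest of the argument knows the algorithm only through this
  inequality.\<close>

lemma blackwell_outcome_inner_le:
  fixes \<mu> :: "'d::finite \<Rightarrow> nat \<Rightarrow> real" and orc a1 \<rho> b
  defines "r \<equiv> blackwell_outcome orc a1 \<rho> b"
  assumes pos: "\<And>j. \<mu> j t > 0"
    and orc: "blackwell_oracle A B (weighted_inner \<mu>) nonpos_orthant R orc"
    and "\<rho> t \<in> R" "b t \<in> B" "t \<ge> 1"
  shows "weighted_inner \<mu> t (r t) (pos_part (\<Sum>s = 1..<t. r s)) \<le> 0"
\<comment> \<open>The action \<open>a1\<close> does not come from the oracle, but at time 1 the past
  sum is empty and its positive part is 0.\<close>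
proof (cases "t = 1")
  case True
  then show ?thesis
    by (simp add: weighted_inner_def)
next
  case False
  have "blackwell_action orc a1 \<rho> b t = orc t (\<rho> t) (\<Sum>s = 1..<t. r s)"
    using False \<open>t \<ge> 1\<close>
    by (subst blackwell_action.simps) (simp add: r_def blackwell_outcome_def)
  moreover have "ip_proj (weighted_inner \<mu>) nonpos_orthant t v = v - pos_part v" for v
    using pos by (intro ip_proj_nonpos_orthant) (simp add: less_imp_neq[symmetric])
  moreover have "weighted_inner \<mu> t (\<rho> t (orc t (\<rho> t) v, b t))
      (v - ip_proj (weighted_inner \<mu>) nonpos_orthant t v) \<le> 0" for v
    using orc assms(4-) unfolding blackwell_oracle_def by blast
  ultimately show ?thesis
    by (simp add: r_def blackwell_outcome_def)
qed

text \<open>Induction on \<open>T\<close> with the potential \<open>\<Phi>\<close>, for any sequence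
  whose cross terms have the right sign.\<close>

lemma weighted_inner_pos_part_sum_le:
  fixes \<mu> :: "'d::finite \<Rightarrow> nat \<Rightarrow> real" and r :: "nat \<Rightarrow> real ^ 'd"
  assumes pos: "\<And>j t. t \<ge> 1 \<Longrightarrow> \<mu> j t > 0"
    and anti: "\<And>j. antimono_on {1..} (\<mu> j)"
    and cross: "\<And>t. t \<ge> 1 \<Longrightarrow> weighted_inner \<mu> t (r t) (pos_part (\<Sum>s = 1..<t. r s)) \<le> 0"
    and "T \<ge> 1"
  shows "weighted_inner \<mu> T (pos_part (\<Sum>t = 1..T. r t)) (pos_part (\<Sum>t = 1..T. r t))
    \<le> (\<Sum>t = 1..T. weighted_inner \<mu> t (r t) (r t))"
proof -
  define \<Phi> where "\<Phi> = (\<lambda>t v. weighted_inner \<mu> t (pos_part v) (pos_part v))"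
  have step: "\<Phi> t (\<Sum>s = 1..t. r s) \<le> \<Phi> t (\<Sum>s = 1..<t. r s) + weighted_inner \<mu> t (r t) (r t)"
    if "t \<ge> 1" for t
  proof -
    let ?S = "\<Sum>s = 1..<t. r s"
    have "(\<Sum>s = 1..t. r s) = ?S + r t"
      using that by (simp add: sum.last_plus add.commute)
    then show ?thesis
      using weighted_inner_pos_part_add_le[of \<mu> t ?S "r t"] cross[OF that]
      by (simp add: \<Phi>_def weighted_inner_add_add)
  qed
  from \<open>T \<ge> 1\<close> have "\<Phi> T (\<Sum>t = 1..T. r t) \<le> (\<Sum>t = 1..T. weighted_inner \<mu> t (r t) (r t))"
  proof (induction T rule: nat_induct_at_least)
    case base
    \<comment> \<open>The potential of the empty sum is 0.\<close>
    show ?case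
      using step[of 1] by (simp add: \<Phi>_def weighted_inner_def)
  next
    case (Suc n)
    let ?S = "\<Sum>t = 1..n. r t"
    \<comment> \<open>The vector stays fixed and only the weights move, from time \<open>n\<close>
      to \<open>Suc n\<close>.\<close>
    have "\<Phi> (Suc n) ?S \<le> \<Phi> n ?S"
      unfolding \<Phi>_def using Suc.hyps
      by (intro weighted_inner_mono_weights less_imp_le[OF pos] monotone_onD[OF anti]) auto
    moreover have "{1..<Suc n} = {1..n}"
      by auto
    ultimately show ?case
      using step[of "Suc n"] Suc.IH Suc.hyps by (simp add: sum.nat_ivl_Suc')
  qed
  then show ?thesis
    by (simp add: \<Phi>_def)
qed

theorem corollary3p3:
  fixes A :: "'a set" and B :: "'b set"
    and R :: "('a \<times> 'b \<Rightarrow> real ^ 'd) set"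
    and \<mu> :: "'d::finite \<Rightarrow> nat \<Rightarrow> real"
    and orc :: "nat \<Rightarrow> ('a \<times> 'b \<Rightarrow> real ^ 'd) \<Rightarrow> real ^ 'd \<Rightarrow> 'a"
    and a1 :: 'a
    and \<rho> :: "nat \<Rightarrow> 'a \<times> 'b \<Rightarrow> real ^ 'd"
    and b :: "nat \<Rightarrow> 'b"
    and i :: 'd
    and T :: nat
  assumes "R \<subseteq> A \<times> B \<rightarrow>\<^sub>E UNIV"
    and "\<And>j t. t \<ge> 1 \<Longrightarrow> \<mu> j t > 0"
    and "\<And>j. antimono_on {1..} (\<mu> j)"
    and "blackwell_condition A B (weighted_inner \<mu>) nonpos_orthant R"
    and "blackwell_oracle A B (weighted_inner \<mu>) nonpos_orthant R orc"
    and "a1 \<in> A"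
    and "\<And>t. t \<ge> 1 \<Longrightarrow> \<rho> t \<in> R"
    and "\<And>t. t \<ge> 1 \<Longrightarrow> b t \<in> B"
    and "T \<ge> 1"
  shows "1 / real T * (\<Sum>t = 1..T. blackwell_outcome orc a1 \<rho> b t $ i)
    \<le> 1 / (real T * \<mu> i T)
        * sqrt (\<Sum>t = 1..T. (ip_norm (weighted_inner \<mu>) t (blackwell_outcome orc a1 \<rho> b t))\<^sup>2)"
proof -
  define r where "r = blackwell_outcome orc a1 \<rho> b"
  define S where "S = (\<Sum>t = 1..T. r t)"
  have "weighted_inner \<mu> t (r t) (pos_part (\<Sum>s = 1..<t. r s)) \<le> 0" if "t \<ge> 1" for t
    unfolding r_def
    by (rule blackwell_outcome_inner_le[OF _ assms(5)]) (use that assms in auto)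
  then have bound: "weighted_inner \<mu> T (pos_part S) (pos_part S)
      \<le> (\<Sum>t = 1..T. weighted_inner \<mu> t (r t) (r t))"
    unfolding S_def by (intro weighted_inner_pos_part_sum_le assms) auto
  \<comment> \<open>The left side is one summand of a sum of nonnegative terms.\<close>
  have "(\<mu> i T * max (S $ i) 0)\<^sup>2 \<le> weighted_inner \<mu> T (pos_part S) (pos_part S)"
    unfolding weighted_inner_def mult.assoc
    by (rule order_trans[OF _ member_le_sum[of i]])
      (simp_all add: power_mult_distrib flip: power2_eq_square)
  then have "\<mu> i T * max (S $ i) 0 \<le> sqrt (\<Sum>t = 1..T. weighted_inner \<mu> t (r t) (r t))"
    using bound by (intro real_le_rsqrt) linarith
  moreover have \<mu>: "\<mu> i T > 0"
    using assms by auto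
  then have "\<mu> i T * S $ i \<le> \<mu> i T * max (S $ i) 0"
    by simp
  ultimately have "\<mu> i T * S $ i \<le> sqrt (\<Sum>t = 1..T. weighted_inner \<mu> t (r t) (r t))"
    by linarith
  then have "S $ i / real T \<le> sqrt (\<Sum>t = 1..T. weighted_inner \<mu> t (r t) (r t)) / (real T * \<mu> i T)"
    using \<mu> \<open>T \<ge> 1\<close> by (simp add: field_simps)
  then show ?thesis
    by (simp add: ip_norm_weighted_inner_sq S_def flip: r_def)
qed

end
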